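(* Let $P(z)=\sum_{j=0}^{m}A_jz^j$ be a matrix polynomial of degree $m$ with coefficients $A_j\in\mathbb{M}_{n\times n}$, where $A_0$ and $A_m$ are non-singular. Then for any $p>1$ and $q>1$ with $\frac{1}{p}+\frac{1}{q}=1$, all the eigenvalues $z$ of $P$ lie in $$|z|<\left[1+\left(\mathcal{A}_p\right)^q\right]^{1/q},$$ where $$\mathcal{A}_p=\left[\sum_{j=0}^{m-1}\left(\frac{\|A_j\|}{\|A_m^{-1}\|^{-1}}\right)^p\right]^{1/p}.$$
   Context: $\mathbb{M}_{n\times n}$ denotes the set of all $n\times n$ matrices with entries in $\mathbb{C}$. A matrix polynomial is a function $P:\mathbb{C}\to\mathbb{M}_{n\times n}$ of the form $P(z)=\sum_{j=0}^{m}A_jz^j$ with $A_j\in\mathbb{M}_{n\times n}$; it has degree $m$ if $A_m\neq 0$. An eigenvalue of $P$ is a number $\lambda\in\mathbb{C}$ for which there exists a non-zero vector $u\in\mathbb{C}^n$ with $P(\lambda)u=0$. Throughout, $\|\cdot\|$ denotes a subordinate matrix norm on $\mathbb{M}_{n\times n}$, i.e. the operator norm induced by a vector norm on $\mathbb{C}^n$. *)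

theory Defs
  imports "HOL-Analysis.Analysis"
begin

definition is_vector_norm :: "(complex ^ 'n \<Rightarrow> real) \<Rightarrow> bool" where
  "is_vector_norm N \<longleftrightarrow>
     (\<forall>x. N x \<ge> 0) \<and>
     (\<forall>x. N x = 0 \<longleftrightarrow> x = 0) \<and>
     (\<forall>c x. N (c *s x) = cmod c * N x) \<and>
     (\<forall>x y. N (x + y) \<le> N x + N y)"

text \<open>The library's operator norm \<open>onorm\<close> is tied to the norm of the type class, which on
  \<open>complex ^ 'n\<close> is the Euclidean one; here the underlying vector norm is a parameter. The supremum
  is over a non-empty set, as index types are non-empty, and it is bounded if \<open>N\<close> is a norm.\<close>

definition subordinate_norm :: "(complex ^ 'n \<Rightarrow> real) \<Rightarrow> complex ^ 'n ^ 'n \<Rightarrow> real" where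
  "subordinate_norm N M = (SUP x\<in>{x. x \<noteq> 0}. N (M *v x) / N x)"

text \<open>\<open>*s\<close> scales vectors by entries, so it is applied to each row of the coefficient matrix.\<close>

definition matrix_poly :: "(nat \<Rightarrow> complex ^ 'n ^ 'n) \<Rightarrow> nat \<Rightarrow> complex \<Rightarrow> complex ^ 'n ^ 'n" where
  "matrix_poly A m z = (\<Sum>j\<le>m. (\<chi> i. z ^ j *s A j $ i))"

definition matrix_poly_eigenvalue :: "(complex \<Rightarrow> complex ^ 'n ^ 'n) \<Rightarrow> complex \<Rightarrow> bool" where
  "matrix_poly_eigenvalue P z \<longleftrightarrow> (\<exists>u. u \<noteq> 0 \<and> P z *v u = 0)"

definition coeff_ratio_norm ::
    "(complex ^ 'n \<Rightarrow> real) \<Rightarrow> (nat \<Rightarrow> complex ^ 'n ^ 'n) \<Rightarrow> nat \<Rightarrow> real \<Rightarrow> real" where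
  "coeff_ratio_norm N A m p =
     (\<Sum>j<m. (subordinate_norm N (A j) / inverse (subordinate_norm N (matrix_inv (A m)))) powr p)
       powr (1 / p)"

end

theory Submission
  imports Defs
begin

text \<open>Let \<open>u\<close> be an eigenvector for \<open>z\<close> and put \<open>r = |z|\<close>. Multiplying \<open>P(z)u = 0\<close> by the inverse
  of the leading coefficient isolates \<open>z\<^sup>m u\<close>, and taking norms turns the matrix problem into the
  scalar inequality \<open>r\<^sup>m \<le> \<Sum>j<m. a\<^sub>j r\<^sup>j\<close>, where \<open>a\<^sub>j\<close> is the product of the norms of \<open>A\<^sub>j\<close> and of
  that inverse (\<open>eigenvalue_scalar_inequality\<close>). This is Cauchy's classical argument for
  scalar polynomials, and its only matrix ingredient is that a subordinate norm is consistent with its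
  vector norm (\<open>subordinate_norm_bound\<close>). Consistency needs the supremum defining the subordinate
  norm to be finite, which follows from compactness of the Euclidean sphere.

  The scalar inequality is then exploited by Hoelder's inequality (\<open>Holder_sum\<close>). Writing
  \<open>x = r\<^sup>q\<close> and \<open>B\<close> for the \<open>q\<close>-th power of the \<open>p\<close>-norm of the \<open>a\<^sub>j\<close>, it yields
  \<open>x\<^sup>m \<le> B (1 + x + \<dots> + x\<^sup>m\<^sup>-\<^sup>1)\<close>. If \<open>x \<ge> 1 + B\<close>, then \<open>B \<le> x - 1\<close> and the geometric sum
  collapses the right-hand side to at most \<open>x\<^sup>m - 1\<close>, which is absurd. So \<open>x < 1 + B\<close>, and the bound,
  with its strict sign, is the \<open>q\<close>-th root of this.\<close>

section \<open>Subordinate norms are consistent\<close>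

lemma vector_norm_nonneg: "is_vector_norm N \<Longrightarrow> N x \<ge> 0"
  and vector_norm_eq_0_iff: "is_vector_norm N \<Longrightarrow> N x = 0 \<longleftrightarrow> x = 0"
  and vector_norm_scale: "is_vector_norm N \<Longrightarrow> N (c *s x) = cmod c * N x"
  and vector_norm_triangle: "is_vector_norm N \<Longrightarrow> N (x + y) \<le> N x + N y"
  by (auto simp: is_vector_norm_def)

lemma vector_norm_pos: "is_vector_norm N \<Longrightarrow> x \<noteq> 0 \<Longrightarrow> N x > 0"
  using vector_norm_nonneg[of N x] vector_norm_eq_0_iff[of N x] by linarith

lemma scaleR_eq_vector_smult: "c *\<^sub>R x = complex_of_real c *s x"
  for x :: "complex ^ 'n"
  by (simp add: vec_eq_iff complex_eq_iff)

lemma vector_norm_scaleR: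
  assumes "is_vector_norm N"
  shows "N (c *\<^sub>R x) = \<bar>c\<bar> * N x"
  by (simp add: scaleR_eq_vector_smult vector_norm_scale[OF assms])

lemma vector_norm_minus:
  assumes "is_vector_norm N"
  shows "N (- x) = N x"
  using vector_norm_scaleR[OF assms, of "-1" x] by simp

lemma vector_norm_sum_le:
  assumes "is_vector_norm N"
  shows "N (\<Sum>j\<in>I. f j) \<le> (\<Sum>j\<in>I. N (f j))"
proof (induction I rule: infinite_finite_induct)
  case (insert j I)
  then show ?case
    using vector_norm_triangle[OF assms, of "f j" "sum f I"] by simp
qed (simp_all add: vector_norm_eq_0_iff[OF assms, THEN iffD2])

text \<open>A norm is convex, and a finite convex function on a finite-dimensional space is continuous.\<close>

lemma continuous_on_vector_norm:
  assumes "is_vector_norm N"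
  shows "continuous_on S N"
proof -
  have "convex_on UNIV N"
  proof (rule convex_onI)
    fix t :: real and x y
    assume "0 < t" "t < 1"
    then show "N ((1 - t) *\<^sub>R x + t *\<^sub>R y) \<le> (1 - t) * N x + t * N y"
      using vector_norm_triangle[OF assms, of "(1 - t) *\<^sub>R x" "t *\<^sub>R y"]
      by (simp add: vector_norm_scaleR[OF assms])
  qed simp
  then show ?thesis
    using convex_on_continuous[OF open_UNIV] continuous_on_subset by blast
qed

text \<open>The quotient is invariant under scaling, so its values on all non-zero vectors are already
  taken on the Euclidean unit sphere, where it is continuous.\<close>

lemma bdd_above_subordinate_norm:
  assumes "is_vector_norm N"
  shows "bdd_above ((\<lambda>x. N (M *v x) / N x) ` {x. x \<noteq> 0})"
proof -
  let ?f = "\<lambda>x. N (M *v x) / N x"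
  have "continuous_on (sphere 0 1) (\<lambda>x. N (M *v x))"
    by (rule continuous_on_compose2[OF continuous_on_vector_norm[OF assms, of UNIV]])
       (auto intro: linear_continuous_on)
  then have "continuous_on (sphere 0 1) ?f"
    using continuous_on_vector_norm[OF assms]
    by (intro continuous_on_divide) (auto simp: vector_norm_eq_0_iff[OF assms])
  then have "bdd_above (?f ` sphere 0 1)"
    by (intro bounded_imp_bdd_above compact_imp_bounded compact_continuous_image) auto
  moreover have "?f ` {x. x \<noteq> 0} \<subseteq> ?f ` sphere 0 1"
  proof clarify
    fix x :: "complex ^ 'a"
    assume "x \<noteq> 0"
    then have "?f x = ?f ((1 / norm x) *\<^sub>R x)"
      by (simp add: scaleR_eq_vector_smult vector_scalar_commute vector_norm_scale[OF assms]
          norm_divide)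
    moreover have "(1 / norm x) *\<^sub>R x \<in> sphere 0 1"
      using \<open>x \<noteq> 0\<close> by simp
    ultimately show "?f x \<in> ?f ` sphere 0 1"
      by (rule image_eqI)
  qed
  ultimately show ?thesis
    by (rule bdd_above_mono)
qed

lemma subordinate_norm_bound:
  assumes "is_vector_norm N"
  shows "N (M *v x) \<le> subordinate_norm N M * N x"
proof (cases "x = 0")
  case True
  then show ?thesis
    using vector_norm_eq_0_iff[OF assms, of 0] by simp
next
  case False
  then have "N (M *v x) / N x \<le> subordinate_norm N M"
    unfolding subordinate_norm_def
    by (intro cSUP_upper bdd_above_subordinate_norm[OF assms]) simp
  then show ?thesis
    using vector_norm_pos[OF assms False] by (simp add: divide_le_eq)
qed

lemma subordinate_norm_nonneg:
  assumes "is_vector_norm N"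
  shows "subordinate_norm N M \<ge> 0"
proof -
  have *: "(1 :: complex ^ 'a) \<noteq> 0"
    by (simp add: vec_eq_iff)
  have "0 \<le> N (M *v 1)"
    by (rule vector_norm_nonneg[OF assms])
  also have "\<dots> \<le> subordinate_norm N M * N 1"
    by (rule subordinate_norm_bound[OF assms])
  finally show ?thesis
    using vector_norm_pos[OF assms *] by (simp add: zero_le_mult_iff)
qed

section \<open>From eigenvectors to a scalar inequality\<close>

lemma matrix_poly_mult_vector:
  "matrix_poly A m z *v u = (\<Sum>j\<le>m. z ^ j *s (A j *v u))"
proof -
  have "(\<Sum>k\<in>UNIV. (\<Sum>j\<le>m. z ^ j * A j $ i $ k) * u $ k)
      = (\<Sum>j\<le>m. z ^ j * (\<Sum>k\<in>UNIV. A j $ i $ k * u $ k))" for i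
    unfolding sum_distrib_right sum_distrib_left mult.assoc by (rule sum.swap)
  then show ?thesis
    by (simp add: vec_eq_iff matrix_poly_def matrix_vector_mult_def)
qed

lemma matrix_inv_mult_vector:
  fixes M :: "'a::semiring_1 ^ 'n ^ 'm"
  assumes "invertible M"
  shows "matrix_inv M *v (M *v u) = u"
proof -
  have "matrix_inv M ** M = mat 1"
    using assms unfolding invertible_def matrix_inv_def by (rule someI2_ex) blast
  then show ?thesis
    by (simp add: matrix_vector_mul_assoc)
qed

text \<open>For \<open>m = 0\<close> the conclusion is the contradiction \<open>1 \<le> 0\<close>: an invertible constant has no
  eigenvalues.\<close>

lemma eigenvalue_scalar_inequality:
  assumes N: "is_vector_norm N"
    and inv: "invertible (A m)"
    and eig: "matrix_poly_eigenvalue (matrix_poly A m) z"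
  shows "cmod z ^ m \<le>
    (\<Sum>j<m. subordinate_norm N (A j) * subordinate_norm N (matrix_inv (A m)) * cmod z ^ j)"
proof -
  let ?B = "matrix_inv (A m)"
  obtain u where u: "u \<noteq> 0" and "matrix_poly A m z *v u = 0"
    using eig by (auto simp: matrix_poly_eigenvalue_def)
  then have "(\<Sum>j<m. z ^ j *s (A j *v u)) + z ^ m *s (A m *v u) = 0"
    by (simp only: matrix_poly_mult_vector lessThan_Suc_atMost[symmetric] sum.lessThan_Suc)
  then have image: "A m *v (z ^ m *s u) = - (\<Sum>j<m. z ^ j *s (A j *v u))"
    unfolding vector_scalar_commute by (simp only: eq_neg_iff_add_eq_0 add.commute)
  have "z ^ m *s u = ?B *v (- (\<Sum>j<m. z ^ j *s (A j *v u)))"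
    by (simp only: image[symmetric] matrix_inv_mult_vector[OF inv])
  then have "N (z ^ m *s u) = N (?B *v (- (\<Sum>j<m. z ^ j *s (A j *v u))))"
    by (rule arg_cong)
  also have "\<dots> \<le> subordinate_norm N ?B * N (\<Sum>j<m. z ^ j *s (A j *v u))"
    using subordinate_norm_bound[OF N, of ?B "- (\<Sum>j<m. z ^ j *s (A j *v u))"]
    by (simp only: vector_norm_minus[OF N])
  also have "\<dots> \<le> subordinate_norm N ?B * (\<Sum>j<m. N (z ^ j *s (A j *v u)))"
    by (intro mult_left_mono vector_norm_sum_le[OF N] subordinate_norm_nonneg[OF N])
  also have "\<dots> \<le> subordinate_norm N ?B *
      (\<Sum>j<m. cmod z ^ j * (subordinate_norm N (A j) * N u))"
    unfolding vector_norm_scale[OF N] norm_power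
    by (intro mult_left_mono sum_mono subordinate_norm_bound[OF N] subordinate_norm_nonneg[OF N])
       simp
  also have "\<dots> =
      (\<Sum>j<m. subordinate_norm N (A j) * subordinate_norm N ?B * cmod z ^ j) * N u"
    unfolding sum_distrib_left sum_distrib_right by (rule sum.cong[OF refl]) algebra
  finally show ?thesis
    using vector_norm_pos[OF N u]
    by (simp only: vector_norm_scale[OF N] norm_power mult_le_cancel_right_pos)
qed

section \<open>Solving the scalar inequality\<close>

text \<open>Normalise both families to have norm one and add up Young's inequality: the right-hand sides
  add up to \<open>1 / p + 1 / q = 1\<close>.\<close>

lemma Holder_sum:
  fixes f g :: "'a \<Rightarrow> real" and p q :: real
  assumes pq: "p > 1" "q > 1" "1 / p + 1 / q = 1"
    and nonneg: "\<And>i. i \<in> I \<Longrightarrow> f i \<ge> 0" "\<And>i. i \<in> I \<Longrightarrow> g i \<ge> 0"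
  shows "(\<Sum>i\<in>I. f i * g i) \<le>
    (\<Sum>i\<in>I. f i powr p) powr (1 / p) * (\<Sum>i\<in>I. g i powr q) powr (1 / q)"
proof (cases "finite I")
  case False
  then show ?thesis by simp
next
  case fin: True
  define F where "F = (\<Sum>i\<in>I. f i powr p) powr (1 / p)"
  define G where "G = (\<Sum>i\<in>I. g i powr q) powr (1 / q)"
  have Fp: "F powr p = (\<Sum>i\<in>I. f i powr p)" and Gq: "G powr q = (\<Sum>i\<in>I. g i powr q)"
    using pq by (simp_all add: F_def G_def powr_powr sum_nonneg)
  have "F \<ge> 0" "G \<ge> 0"
    by (simp_all add: F_def G_def)
  show ?thesis
  proof (cases "F = 0 \<or> G = 0")
    case True
    then have "\<forall>i\<in>I. f i = 0 \<or> g i = 0"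
      using fin by (auto simp: F_def G_def sum_nonneg_eq_0_iff)
    then have "(\<Sum>i\<in>I. f i * g i) = 0"
      by (intro sum.neutral) auto
    then show ?thesis
      by simp
  next
    case False
    with \<open>F \<ge> 0\<close> \<open>G \<ge> 0\<close> have pos: "F > 0" "G > 0"
      by auto
    have "(\<Sum>i\<in>I. f i / F * (g i / G)) \<le>
        (\<Sum>i\<in>I. (f i / F) powr p / p + (g i / G) powr q / q)"
      using pos nonneg by (intro sum_mono Youngs_inequality pq) auto
    also have "\<dots> = (\<Sum>i\<in>I. f i powr p) / F powr p / p + (\<Sum>i\<in>I. g i powr q) / G powr q / q"
      using pos nonneg by (simp add: powr_divide sum.distrib sum_divide_distrib)
    also have "\<dots> = 1"
      using pos pq by (simp flip: Fp Gq)
    finally have "(\<Sum>i\<in>I. f i * g i) / (F * G) \<le> 1"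
      by (simp add: sum_divide_distrib)
    then show ?thesis
      using pos by (simp add: divide_le_eq F_def G_def)
  qed
qed

text \<open>Hoelder's inequality pairs the coefficients with the powers of \<open>r\<close>, and the \<open>q\<close>-th powers of
  the latter form the geometric progression in \<open>x = r powr q\<close>. Arguing by contradiction from
  \<open>x \<ge> 1 + S powr q\<close> lets \<open>x - 1\<close> replace \<open>S powr q\<close>, so the geometric sum telescopes without
  a division and without separating the cases \<open>x < 1\<close>, \<open>x = 1\<close>, \<open>x > 1\<close>.\<close>

lemma scalar_inequality_bound:
  fixes a :: "nat \<Rightarrow> real" and p q r :: real
  assumes pq: "p > 1" "q > 1" "1 / p + 1 / q = 1"
    and a: "\<And>j. j < m \<Longrightarrow> a j \<ge> 0"
    and r: "r \<ge> 0"
    and le: "r ^ m \<le> (\<Sum>j<m. a j * r ^ j)"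
  shows "r < (1 + ((\<Sum>j<m. a j powr p) powr (1 / p)) powr q) powr (1 / q)"
proof -
  define S where "S = (\<Sum>j<m. a j powr p) powr (1 / p)"
  define x where "x = r powr q"
  have "x \<ge> 0"
    by (simp add: x_def)
  have power: "(r ^ j) powr q = x ^ j" for j
    unfolding x_def by (induction j) (use r in \<open>simp_all add: powr_mult\<close>)
  have "r ^ m \<le> S * (\<Sum>j<m. (r ^ j) powr q) powr (1 / q)"
    using le Holder_sum[OF pq, of "{..<m}" a "\<lambda>j. r ^ j"] a r by (simp add: S_def)
  then have "(r ^ m) powr q \<le> (S * (\<Sum>j<m. x ^ j) powr (1 / q)) powr q"
    using r pq by (intro powr_mono2) (simp_all add: power)
  then have main: "x ^ m \<le> S powr q * (\<Sum>j<m. x ^ j)"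
    using pq \<open>x \<ge> 0\<close> by (simp add: power powr_mult powr_powr sum_nonneg)
  have "x < 1 + S powr q"
  proof (rule ccontr)
    assume "\<not> x < 1 + S powr q"
    then have "S powr q * (\<Sum>j<m. x ^ j) \<le> (x - 1) * (\<Sum>j<m. x ^ j)"
      using \<open>x \<ge> 0\<close> by (intro mult_right_mono sum_nonneg) auto
    also have "\<dots> = x ^ m - 1"
      by (rule power_diff_1_eq[symmetric])
    finally show False
      using main by simp
  qed
  then have "x powr (1 / q) < (1 + S powr q) powr (1 / q)"
    using pq \<open>x \<ge> 0\<close> by (intro powr_less_mono2) auto
  then show ?thesis
    using r pq by (simp add: x_def S_def powr_powr)
qed

section \<open>The eigenvalue bound\<close>

theorem theorem2:
  fixes A :: "nat \<Rightarrow> complex ^ 'n ^ 'n" and P :: "complex \<Rightarrow> complex ^ 'n ^ 'n"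
    and N :: "complex ^ 'n \<Rightarrow> real" and m :: nat and p q :: real and z :: complex
  assumes "is_vector_norm N"
    and "P = matrix_poly A m"
    and "A m \<noteq> 0"
    and "invertible (A 0)"
    and "invertible (A m)"
    and "p > 1"
    and "q > 1"
    and "1 / p + 1 / q = 1"
    and "matrix_poly_eigenvalue P z"
  shows "cmod z < (1 + coeff_ratio_norm N A m p powr q) powr (1 / q)"
proof -
  let ?a = "\<lambda>j. subordinate_norm N (A j) * subordinate_norm N (matrix_inv (A m))"
  have "cmod z < (1 + ((\<Sum>j<m. ?a j powr p) powr (1 / p)) powr q) powr (1 / q)"
  proof (rule scalar_inequality_bound)
    show "cmod z ^ m \<le> (\<Sum>j<m. ?a j * cmod z ^ j)"
      using assms eigenvalue_scalar_inequality by blast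
    show "?a j \<ge> 0" for j
      by (intro mult_nonneg_nonneg subordinate_norm_nonneg assms)
  qed (use assms in auto)
  then show ?thesis
    by (simp add: coeff_ratio_norm_def divide_inverse)
qed

end
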